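(* Let $p^*\in\mathcal{P}$ be a probability distribution over $\mathcal{X}\times\mathcal{Y}$, let $1\le T\le K\le L$ and $1\le N\le L$, and let $C\subseteq\mathcal{X}$ be the set of all $x$ such that the sequence $$y^\dagger=\arg\max_{y\in\mathcal{Y}}\sum_{i=1}^{L-N+1}p^*(y_{i:i+N-1}\mid x)$$ satisfies, for every integer $c\ge0$ with $Tc<L$, $$y^\dagger_{(Tc+1):\min\{Tc+T,L\}}=\Big(\arg\max_{y_{(Tc+1):\min\{Tc+K,L\}}}\,p^*\big(y_{(Tc+1):\min\{Tc+K,L\}}\mid x,\,y^\dagger_{[Tc]}\big)\Big)_{[T]},$$ where $(\cdot)_{[T]}$ denotes the first $T$ tokens (all tokens if there are fewer than $T$). Then $K_T$-lookahead decoding is optimal for the $N$-gram Hamming loss for $p^*$ if and only if $p^*_x(C)=1$, where $p^*_x$ is the marginal of $p^*$ on $\mathcal{X}$.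
   Context: $\mathcal{X}$ is an input (measurable) space, $\mathcal{V}$ a finite vocabulary, $*\notin\mathcal{V}$ a null (padding) token, $L\in\mathbb{N}$, and $\mathcal{Y}$ is a set of sequences of length $L$ of the form $y_1\cdots y_j*\cdots*$ with $y_i\in\mathcal{V}$, $j\le L$. Write $\overline{\mathcal V}=\mathcal V\cup\{*\}$, $y_{[i]}=y_1\cdots y_i$, $y_{i:j}=y_i\cdots y_j$; $p^*(y_{i:i+N-1}\mid x)$ is the marginal probability, under $p^*(\cdot\mid x)$, that positions $i,\dots,i+N-1$ equal $y_{i:i+N-1}$. The next-token predictor $p^*_{ntp}$ of $p^*$ is the family of conditionals $p^*(\cdot\mid x,y_{[i-1]})$ on $\overline{\mathcal V}$ (a fixed version is chosen for every prefix, and once a prefix contains $*$ all mass of the next token is on $*$). $K_T$-lookahead decoding with next-token predictor $q$ on input $x$: start with the empty string $y$. While $\mathrm{length}(y)<L$: put $c=\min\{K,L-\mathrm{length}(y)\}$, let $y'$ be the maximizer over $v_1,\dots,v_c\in\overline{\mathcal V}$ of $q(v_1\mid x,y)\,q(v_2\mid x,y v_1)\cdots q(v_c\mid x,y v_1\cdots v_{c-1})$, and append to $y$ the first $\min\{T,L-\mathrm{length}(y)\}$ tokens of $y'$. The class $\mathcal{P}$ consists of the probability distributions $p$ on $\mathcal X\times\mathcal Y$ having no ties: for every $x$, for all $1\le N\le L$ the maximizer over $y\in\mathcal Y$ of $\sum_{i=1}^{L-N+1}p(y_{i:i+N-1}\mid x)$ is unique, and for all $1\le T\le K\le L$ every maximizer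 encountered when running $K_T$-lookahead with the next-token predictor of $p$ on $x$ is unique. The $N$-gram Hamming loss is $\ell(\hat y,y)=\sum_{i=1}^{L-N+1}\mathbf 1\{\hat y_{i:i+N-1}\ne y_{i:i+N-1}\}$. A deterministic decoder $\mathcal D$, outputting $\hat y(x)$ when using $p^*_{ntp}$ on input $x$, is optimal for $p^*$ if $\mathbb E_{(x,y)\sim p^*}[\ell(\hat y(x),y)]=\inf_{h:\mathcal X\to\mathcal Y}\mathbb E_{(x,y)\sim p^*}[\ell(h(x),y)]$ (infimum over measurable $h$). *)

theory Defs
  imports "HOL-Probability.Probability" "HOL-Library.While_Combinator"
begin

text \<open>
  The vocabulary is a finite type \<^typ>\<open>'v\<close>; the extended vocabulary is \<^typ>\<open>'v option\<close>, with
  \<^term>\<open>None\<close> as the padding token. Strings are lists; \<^term>\<open>take i y\<close> is $y_{[i]}$.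
\<close>

definition padded :: "nat \<Rightarrow> 'v option list \<Rightarrow> bool" where
  "padded L y \<longleftrightarrow> (\<exists>w. length w \<le> L \<and> y = map Some w @ replicate (L - length w) None)"

text \<open>$y_{i:j}$, with positions counted from 1 and both ends included.\<close>

definition seg :: "'a list \<Rightarrow> nat \<Rightarrow> nat \<Rightarrow> 'a list" where
  "seg y i j = take (j + 1 - i) (drop (i - 1) y)"

definition ngram_loss :: "nat \<Rightarrow> nat \<Rightarrow> 'a list \<Rightarrow> 'a list \<Rightarrow> real" where
  "ngram_loss L N y' y =
     (\<Sum>i = 1..L - N + 1. of_bool (seg y' i (i + N - 1) \<noteq> seg y i (i + N - 1)))"

text \<open>
  Probability distributions on $\mathcal X\times\mathcal Y$, where $\mathcal X$ is \<^term>\<open>space M\<close>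
  and the set of sequences \<^term>\<open>Y\<close> carries the discrete sigma-algebra.
\<close>

definition joint_distribution ::
  "'x measure \<Rightarrow> 'v option list set \<Rightarrow> ('x \<times> 'v option list) measure \<Rightarrow> bool" where
  "joint_distribution M Y P \<longleftrightarrow> prob_space P \<and> sets P = sets (M \<Otimes>\<^sub>M count_space Y)"

text \<open>\<^term>\<open>\<kappa>\<close> is a version of the regular conditional distribution $p(\cdot\mid x)$ on \<^term>\<open>Y\<close>.\<close>

definition output_version ::
  "'x measure \<Rightarrow> 'v option list set \<Rightarrow> ('x \<times> 'v option list) measure
    \<Rightarrow> ('x \<Rightarrow> 'v option list pmf) \<Rightarrow> bool" where
  "output_version M Y P \<kappa> \<longleftrightarrow>
     (\<forall>x\<in>space M. set_pmf (\<kappa> x) \<subseteq> Y) \<and>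
     (\<forall>y\<in>Y. (\<lambda>x. pmf (\<kappa> x) y) \<in> borel_measurable M) \<and>
     (\<forall>A\<in>sets M. \<forall>y\<in>Y.
        measure P (A \<times> {y}) = (\<integral>z. indicator A (fst z) * pmf (\<kappa> (fst z)) y \<partial>P))"

text \<open>
  \<^term>\<open>q\<close> is a next-token predictor of \<^term>\<open>P\<close>: for every prefix \<^term>\<open>s\<close>, \<^term>\<open>q x s\<close> is a version
  of the conditional distribution of the next token given the input and the prefix. The integral
  equation leaves it undetermined where \<^term>\<open>s\<close> has conditional probability 0; only the convention
  for prefixes containing the padding token is imposed there.
\<close>

definition ntp_version ::
  "'x measure \<Rightarrow> nat \<Rightarrow> ('x \<times> 'v option list) measure
    \<Rightarrow> ('x \<Rightarrow> 'v option list \<Rightarrow> 'v option pmf) \<Rightarrow> bool" where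
  "ntp_version M L P q \<longleftrightarrow>
     (\<forall>s. length s < L \<longrightarrow>
        (\<forall>x\<in>space M. None \<in> set s \<longrightarrow> q x s = return_pmf None) \<and>
        (\<forall>v. (\<lambda>x. pmf (q x s) v) \<in> borel_measurable M \<and>
           (\<forall>A\<in>sets M.
              measure P {z \<in> space P. fst z \<in> A \<and> take (length s + 1) (snd z) = s @ [v]} =
              (\<integral>z. indicator A (fst z) * of_bool (take (length s) (snd z) = s)
                     * pmf (q (fst z) s) v \<partial>P))))"

text \<open>$q(v_1\cdots v_c\mid x,s)=\prod_i q(v_i\mid x,s\,v_1\cdots v_{i-1})$.\<close>

definition cont_prob ::
  "('x \<Rightarrow> 'v option list \<Rightarrow> 'v option pmf) \<Rightarrow> 'x \<Rightarrow> 'v option list \<Rightarrow> 'v option list \<Rightarrow> real" where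
  "cont_prob q x s w = (\<Prod>i<length w. pmf (q x (s @ take i w)) (w ! i))"

definition best_cont ::
  "('x \<Rightarrow> 'v option list \<Rightarrow> 'v option pmf) \<Rightarrow> 'x \<Rightarrow> 'v option list \<Rightarrow> nat \<Rightarrow> 'v option list" where
  "best_cont q x s c = arg_max_on (cont_prob q x s) {w. length w = c}"

definition lookahead_step ::
  "nat \<Rightarrow> nat \<Rightarrow> nat \<Rightarrow> ('x \<Rightarrow> 'v option list \<Rightarrow> 'v option pmf) \<Rightarrow> 'x
    \<Rightarrow> 'v option list \<Rightarrow> 'v option list" where
  "lookahead_step L K T q x y =
     y @ take (min T (L - length y)) (best_cont q x y (min K (L - length y)))"

definition lookahead ::
  "nat \<Rightarrow> nat \<Rightarrow> nat \<Rightarrow> ('x \<Rightarrow> 'v option list \<Rightarrow> 'v option pmf) \<Rightarrow> 'x \<Rightarrow> 'v option list" where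
  "lookahead L K T q x = while (\<lambda>y. length y < L) (lookahead_step L K T q x) []"

text \<open>$\sum_{i=1}^{L-N+1}p(y_{i:i+N-1}\mid x)$\<close>

definition ngram_score ::
  "nat \<Rightarrow> nat \<Rightarrow> ('x \<Rightarrow> 'v option list pmf) \<Rightarrow> 'x \<Rightarrow> 'v option list \<Rightarrow> real" where
  "ngram_score L N \<kappa> x y =
     (\<Sum>i = 1..L - N + 1.
        measure_pmf.prob (\<kappa> x) {z. seg z i (i + N - 1) = seg y i (i + N - 1)})"

text \<open>
  In the second clause of \<open>no_ties\<close>, \<^term>\<open>y\<close> runs over the strings at which the loop of
  $K_T$-lookahead on \<^term>\<open>x\<close> computes a maximizer.
\<close>

definition no_ties ::
  "'x measure \<Rightarrow> nat \<Rightarrow> 'v option list set \<Rightarrow> ('x \<Rightarrow> 'v option list pmf)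
    \<Rightarrow> ('x \<Rightarrow> 'v option list \<Rightarrow> 'v option pmf) \<Rightarrow> bool" where
  "no_ties M L Y \<kappa> q \<longleftrightarrow>
     (\<forall>x\<in>space M.
        (\<forall>N. 1 \<le> N \<and> N \<le> L \<longrightarrow> (\<exists>!y. is_arg_max (ngram_score L N \<kappa> x) (\<lambda>y. y \<in> Y) y)) \<and>
        (\<forall>T K. 1 \<le> T \<and> T \<le> K \<and> K \<le> L \<longrightarrow>
           (\<forall>n y. y = (lookahead_step L K T q x ^^ n) [] \<and> length y < L \<longrightarrow>
              (\<exists>!w. is_arg_max (cont_prob q x y) (\<lambda>w. length w = min K (L - length y)) w))))"

text \<open>
  Membership in the class $\mathcal P$. It depends on the fixed versions of the conditionals, since
  ties are excluded for every \<^term>\<open>x\<close> and not just almost everywhere.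
\<close>

definition in_class ::
  "'x measure \<Rightarrow> nat \<Rightarrow> 'v option list set \<Rightarrow> ('x \<times> 'v option list) measure
    \<Rightarrow> ('x \<Rightarrow> 'v option list pmf) \<Rightarrow> ('x \<Rightarrow> 'v option list \<Rightarrow> 'v option pmf) \<Rightarrow> bool" where
  "in_class M L Y P \<kappa> q \<longleftrightarrow>
     joint_distribution M Y P \<and> output_version M Y P \<kappa> \<and> ntp_version M L P q \<and>
     no_ties M L Y \<kappa> q"

definition optimal_decoder ::
  "'x measure \<Rightarrow> nat \<Rightarrow> nat \<Rightarrow> 'v option list set \<Rightarrow> ('x \<times> 'v option list) measure
    \<Rightarrow> ('x \<Rightarrow> 'v option list) \<Rightarrow> bool" where
  "optimal_decoder M L N Y P d \<longleftrightarrow>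
     (\<integral>z. ngram_loss L N (d (fst z)) (snd z) \<partial>P) =
     (INF h\<in>measurable M (count_space Y). \<integral>z. ngram_loss L N (h (fst z)) (snd z) \<partial>P)"

definition y_dagger ::
  "nat \<Rightarrow> nat \<Rightarrow> 'v option list set \<Rightarrow> ('x \<Rightarrow> 'v option list pmf) \<Rightarrow> 'x \<Rightarrow> 'v option list" where
  "y_dagger L N Y \<kappa> x = arg_max_on (ngram_score L N \<kappa> x) Y"

text \<open>
  The prefix $y^\dagger_{[Tc]}$ need not be one at which maximizers are assumed unique; if they are
  not, \<^term>\<open>best_cont\<close> is an arbitrary one. This does not affect the set: if the condition holds for
  all smaller \<^term>\<open>c\<close>, then $y^\dagger_{[Tc]}$ is visited by $K_T$-lookahead on \<^term>\<open>x\<close>.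
\<close>

definition agree_set ::
  "'x measure \<Rightarrow> nat \<Rightarrow> nat \<Rightarrow> nat \<Rightarrow> nat \<Rightarrow> 'v option list set \<Rightarrow> ('x \<Rightarrow> 'v option list pmf)
    \<Rightarrow> ('x \<Rightarrow> 'v option list \<Rightarrow> 'v option pmf) \<Rightarrow> 'x set" where
  "agree_set M L N K T Y \<kappa> q =
     {x \<in> space M. \<forall>c. T * c < L \<longrightarrow>
        seg (y_dagger L N Y \<kappa> x) (T * c + 1) (min (T * c + T) L) =
        take T (best_cont q x (take (T * c) (y_dagger L N Y \<kappa> x)) (min (T * c + K) L - T * c))}"

end

theory Submission imports Defs begin

text \<open>
  Conditionally on \<open>x\<close>, the expected loss of an output \<open>w\<close> is \<open>L - N + 1\<close> minus its score, so
  predicting \<open>y_dagger\<close> is optimal. By uniqueness of the maximizer, a decoder with outputs in \<open>Y\<close>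
  is optimal iff it agrees with \<open>y_dagger\<close> almost surely. Lookahead decoding has almost surely its
  outputs in \<open>Y\<close> because it never leaves the prefixes of positive probability, and the defining
  condition of the set \<open>C\<close> says step by step that it outputs \<open>y_dagger\<close>.
\<close>

section \<open>Maximizers over finite sets: existence and measurable selection\<close>

lemma finite_length_eq: "finite {w :: 'a::finite list. length w = n}"
  using finite_lists_length_eq[of "UNIV :: 'a set" n] by simp

text \<open>\<open>arg_max_on\<close> is a Hilbert choice, so it has the defining property as soon
  as some maximizer exists; finiteness provides one.\<close>

lemma is_arg_max_arg_max_on:
  fixes f :: "'a \<Rightarrow> 'b::linorder"
  assumes "finite S" "S \<noteq> {}"
  shows "is_arg_max f (\<lambda>x. x \<in> S) (arg_max_on f S)"
proof -
  have "Max (f ` S) \<in> f ` S" using assms by simp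
  then obtain x where "x \<in> S" "f x = Max (f ` S)" by (metis imageE)
  then have "is_arg_max f (\<lambda>x. x \<in> S) x"
    using assms by (auto simp: is_arg_max_linorder)
  then show ?thesis unfolding arg_max_on_def arg_max_def by (rule someI)
qed

text \<open>The value chosen by \<^const>\<open>arg_max_on\<close> depends on \<open>x\<close> only through the set of all
  maximizers, so no uniqueness is needed.\<close>

lemma measurable_arg_max_on:
  fixes f :: "'x \<Rightarrow> 'a \<Rightarrow> real"
  assumes "finite S" and "\<And>w. w \<in> S \<Longrightarrow> (\<lambda>x. f x w) \<in> borel_measurable M"
  shows "(\<lambda>x. arg_max_on (f x) S) \<in> M \<rightarrow>\<^sub>M count_space UNIV"
proof -
  define A where "A x = {w \<in> S. \<forall>v\<in>S. f x v \<le> f x w}" for x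
  have A_sets: "A -` {B} \<inter> space M \<in> sets M" if "B \<subseteq> S" for B
  proof -
    \<comment> \<open>Prescribing the whole set of maximizers is a finite Boolean combination of
      comparisons \<open>f x v \<le> f x w\<close>, each of which is measurable.\<close>
    have "A x = B \<longleftrightarrow> (\<forall>w\<in>S. (w \<in> B) = (\<forall>v\<in>S. f x v \<le> f x w))" for x
      using that unfolding A_def by blast
    then have "A -` {B} \<inter> space M =
        {x \<in> space M. \<forall>w\<in>S. (w \<in> B) = (\<forall>v\<in>S. f x v \<le> f x w)}"
      by blast
    also have "\<dots> \<in> sets M"
    proof (rule sets.sets_Collect_finite_All[OF _ \<open>finite S\<close>])
      fix w assume w: "w \<in> S"
      have "{x \<in> space M. \<forall>v\<in>S. f x v \<le> f x w} \<in> sets M"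
      proof (rule sets.sets_Collect_finite_All[OF _ \<open>finite S\<close>])
        fix v assume v: "v \<in> S"
        show "{x \<in> space M. f x v \<le> f x w} \<in> sets M"
          by (rule borel_measurable_le[OF assms(2)[OF v] assms(2)[OF w]])
      qed
      from this sets.sets_Collect_neg[OF this]
      show "{x \<in> space M. (w \<in> B) = (\<forall>v\<in>S. f x v \<le> f x w)} \<in> sets M"
        by (cases "w \<in> B") simp_all
    qed
    finally show ?thesis .
  qed
  have "A x \<subseteq> S" for x by (auto simp: A_def)
  \<comment> \<open>\<open>A\<close> takes values in the finite set \<open>Pow S\<close>, so
    preimages of singletons suffice; the choice from \<open>A x\<close> is then a function on a
    discrete space.\<close>
  then have "A \<in> M \<rightarrow>\<^sub>M count_space (Pow S)"
    using A_sets \<open>finite S\<close> by (simp add: measurable_count_space_eq2)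
  from measurable_compose[OF this, of "\<lambda>B. SOME w. w \<in> B" "count_space UNIV"]
  have "(\<lambda>x. SOME w. w \<in> A x) \<in> M \<rightarrow>\<^sub>M count_space UNIV"
    by simp
  moreover have "arg_max_on (f x) S = (SOME w. w \<in> A x)" for x
    by (simp add: arg_max_on_def arg_max_def is_arg_max_linorder A_def Ball_def)
  ultimately show ?thesis by simp
qed

section \<open>Lookahead decoding\<close>

lemma is_arg_max_best_cont:
  fixes q :: "'x \<Rightarrow> 'v::finite option list \<Rightarrow> 'v option pmf"
  shows "is_arg_max (cont_prob q x s) (\<lambda>w. length w = c) (best_cont q x s c)"
proof -
  have "replicate c None \<in> {w :: 'v option list. length w = c}" by simp
  then have "{w :: 'v option list. length w = c} \<noteq> {}" by blast
  from is_arg_max_arg_max_on[OF finite_length_eq this]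
  show ?thesis by (simp add: best_cont_def)
qed

lemma length_best_cont:
  fixes q :: "'x \<Rightarrow> 'v::finite option list \<Rightarrow> 'v option pmf"
  shows "length (best_cont q x s c) = c"
  using is_arg_max_best_cont[of q x s c] by (simp add: is_arg_max_def)

context
  fixes q :: "'x \<Rightarrow> 'v::finite option list \<Rightarrow> 'v option pmf"
    and L K T :: nat
  assumes TK: "1 \<le> T" "T \<le> K"
begin

text \<open>The cut to \<open>L - length y\<close> tokens is already made in the length of the
  continuation, and \<open>T \<le> K\<close> makes the two nested minima coincide.\<close>

lemma lookahead_step_eq:
  "lookahead_step L K T q x y = y @ take T (best_cont q x y (min K (L - length y)))"
  using TK by (simp add: lookahead_step_def length_best_cont min_def)

lemma length_lookahead_step:
  "length y \<le> L \<Longrightarrow> length (lookahead_step L K T q x y) = min (length y + T) L"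
  using TK by (auto simp: lookahead_step_eq length_best_cont)

lemma length_funpow_lookahead_step:
  "length ((lookahead_step L K T q x ^^ n) []) = min (T * n) L"
  by (induction n) (auto simp: length_lookahead_step)

text \<open>Every step below length \<open>L\<close> appends at least one token because
  \<open>1 \<le> T\<close>, so \<open>L\<close> steps suffice; further steps append nothing, so a
  fixed iteration count may overshoot the end of the loop.\<close>

lemma lookahead_eq_funpow: "lookahead L K T q x = (lookahead_step L K T q x ^^ L) []"
proof -
  let ?b = "lookahead_step L K T q x"
  have "while (\<lambda>y. length y < L) ?b y = (?b ^^ n) y" if "L \<le> length y + n" for n y
    using that
  proof (induction n arbitrary: y)
    case 0
    then show ?case by (subst while_unfold) simp
  next
    case (Suc n)
    show ?case
    proof (cases "length y < L")
      case True
      then have "L \<le> length (?b y) + n"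
        using Suc.prems TK by (simp add: length_lookahead_step)
      then show ?thesis
        using True Suc.IH[of "?b y"] by (subst while_unfold) (simp add: funpow_swap1)
    next
      case False
      then have stop: "?b y = y"
        by (simp add: lookahead_step_def)
      have "(?b ^^ m) y = y" for m by (induction m) (simp_all add: stop)
      then show ?thesis using False by (subst while_unfold) (simp del: funpow.simps)
    qed
  qed
  then show ?thesis by (simp add: lookahead_def)
qed

lemma length_lookahead: "length (lookahead L K T q x) = L"
  using TK by (simp add: lookahead_eq_funpow length_funpow_lookahead_step min_absorb2)

text \<open>Steps only append, so all intermediate states can be read off the final output as
  prefixes.\<close>

lemma take_funpow_lookahead_step:
  "take (length ((lookahead_step L K T q x ^^ n) [])) ((lookahead_step L K T q x ^^ (n + m)) [])
     = (lookahead_step L K T q x ^^ n) []"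
proof (induction m)
  case (Suc m)
  have "length ((lookahead_step L K T q x ^^ n) []) \<le> length ((lookahead_step L K T q x ^^ (n + m)) [])"
    by (auto simp: length_funpow_lookahead_step min_le_iff_disj)
  then show ?case
    using Suc.IH lookahead_step_eq[of x "(lookahead_step L K T q x ^^ (n + m)) []"] by simp
qed simp

text \<open>Prepending the common prefix \<open>take a y\<close> to both windows turns the condition
  defining \<open>agree_set\<close> into a statement about one decoding step.\<close>

lemma seg_eq_best_cont_iff:
  assumes "length y = L" "a < L"
  shows "seg y (a + 1) (min (a + T) L) = take T (best_cont q x (take a y) (min (a + K) L - a))
    \<longleftrightarrow> lookahead_step L K T q x (take a y) = take (a + T) y"
proof -
  have "min (a + K) L - a = min K (L - a)" by auto
  moreover have "seg y (a + 1) (min (a + T) L) = take T (drop a y)"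
    using assms by (auto simp: seg_def min_def)
  ultimately show ?thesis
    using assms by (auto simp: lookahead_step_eq take_add)
qed

lemma lookahead_eq_iff:
  assumes y: "length y = L"
  shows "lookahead L K T q x = y \<longleftrightarrow> (\<forall>c. T * c < L \<longrightarrow>
    seg y (T * c + 1) (min (T * c + T) L) =
    take T (best_cont q x (take (T * c) y) (min (T * c + K) L - T * c)))"
    (is "_ \<longleftrightarrow> ?R")
proof -
  let ?b = "lookahead_step L K T q x"
  have R: "?R \<longleftrightarrow> (\<forall>c. T * c < L \<longrightarrow> ?b (take (T * c) y) = take (T * c + T) y)"
    using y by (auto simp: seg_eq_best_cont_iff[simplified])
  show ?thesis
  proof
    assume look: "lookahead L K T q x = y"
    \<comment> \<open>The output is the \<open>L\<close>-th iterate, so the prefix property is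
      available for the iterates up to \<open>L\<close>.\<close>
    have pre: "(?b ^^ c) [] = take (T * c) y" if "c \<le> L" for c
    proof -
      have "take (min (T * c) L) y = (?b ^^ c) []"
        using take_funpow_lookahead_step[where x = x and n = c and m = "L - c"] look that
        by (simp add: lookahead_eq_funpow length_funpow_lookahead_step)
      then show ?thesis using y by (simp add: min_def split: if_splits)
    qed
    have "?b (take (T * c) y) = take (T * c + T) y" if "T * c < L" for c
    proof -
      \<comment> \<open>This gives \<open>Suc c \<le> L\<close>, so that \<open>pre\<close> also
        covers the state after the step.\<close>
      have "1 * c \<le> T * c" using TK by (intro mult_right_mono) auto
      then have "c < L" using that by linarith
      then show ?thesis using pre[of c] pre[of "Suc c"] by (simp add: add.commute)
    qed
    then show ?R unfolding R by simp
  next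
    assume ?R
    then have step: "?b (take (T * c) y) = take (T * c + T) y" if "T * c < L" for c
      using that unfolding R by blast
    have "(?b ^^ c) [] = take (T * c) y" for c
    proof (induction c)
      case (Suc c)
      show ?case
      proof (cases "T * c < L")
        case True
        then show ?thesis using Suc step[of c] by (simp add: add.commute)
      next
        case False
        \<comment> \<open>From length \<open>L\<close> on, both sides stay equal to
          \<open>y\<close>.\<close>
        then show ?thesis using Suc y by (simp add: lookahead_step_def)
      qed
    qed simp
    from this[of L] show "lookahead L K T q x = y"
      using TK y by (simp add: lookahead_eq_funpow)
  qed
qed

lemma measurable_lookahead:
  assumes q: "\<And>s v. length s < L \<Longrightarrow> (\<lambda>x. pmf (q x s) v) \<in> borel_measurable M"
  shows "lookahead L K T q \<in> M \<rightarrow>\<^sub>M count_space UNIV"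
proof -
  have cont: "(\<lambda>x. cont_prob q x s w) \<in> borel_measurable M"
    if "length w = min K (L - length s)" for s w
    unfolding cont_prob_def using that by (intro borel_measurable_prod q) auto
  have step: "(\<lambda>x. lookahead_step L K T q x s) \<in> M \<rightarrow>\<^sub>M count_space UNIV" for s
  proof -
    have "(\<lambda>x. best_cont q x s (min K (L - length s))) \<in> M \<rightarrow>\<^sub>M count_space UNIV"
      unfolding best_cont_def by (intro measurable_arg_max_on finite_length_eq cont) auto
    then show ?thesis unfolding lookahead_step_def by (rule measurable_compose) simp
  qed
  have "(\<lambda>x. (lookahead_step L K T q x ^^ n) []) \<in> M \<rightarrow>\<^sub>M count_space UNIV" for n
  proof (induction n)
    case (Suc n)
    \<comment> \<open>The previous state ranges over a countable type of strings, so measurability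
      of the step at each fixed string is enough.\<close>
    show ?case using measurable_compose_countable[OF step Suc.IH] by simp
  qed simp
  then show ?thesis by (simp add: lookahead_eq_funpow[abs_def])
qed

end

section \<open>Decoding stays within the support of the conditional distribution\<close>

lemma cont_prob_snoc:
  "cont_prob q x s (w @ [v]) = cont_prob q x s w * pmf (q x (s @ w)) v"
  by (simp add: cont_prob_def nth_append)

text \<open>At inputs where the predictor really gives the conditionals of \<open>p\<close>, decoding never
  leaves the prefixes of positive probability: some continuation of such a prefix has positive
  probability, hence so does the most probable one.\<close>

lemma lookahead_in_set_pmf:
  fixes q :: "'x \<Rightarrow> 'v::finite option list \<Rightarrow> 'v option pmf"
  assumes TK: "1 \<le> T" "T \<le> K"
    and len: "\<And>z. z \<in> set_pmf p \<Longrightarrow> length z = L"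
    and cond: "\<And>s v. length s < L \<Longrightarrow>
      measure_pmf.prob p {z. take (length s + 1) z = s @ [v]} =
      measure_pmf.prob p {z. take (length s) z = s} * pmf (q x s) v"
  shows "lookahead L K T q x \<in> set_pmf p"
proof -
  \<comment> \<open>The probability under \<open>p\<close> that a sequence starts with
    \<open>s\<close>.\<close>
  define g where "g s = measure_pmf.prob p {z. take (length s) z = s}" for s
  have g_pos: "0 < g s \<longleftrightarrow> (\<exists>z\<in>set_pmf p. take (length s) z = s)" for s
    using measure_pmf_zero_iff[of p "{z. take (length s) z = s}"]
    by (auto simp: g_def zero_less_measure_iff)
  \<comment> \<open>The chain rule: the conditionals in \<open>cont_prob\<close> telescope. Prefixes
    of probability 0 cause no trouble, since \<open>cond\<close> is stated as a product and not as a
    quotient.\<close>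
  have g_cont: "g (s @ w) = g s * cont_prob q x s w" if "length s + length w \<le> L" for s w
    using that
  proof (induction w rule: rev_induct)
    case Nil
    show ?case by (simp add: cont_prob_def)
  next
    case (snoc v w)
    then show ?case
      using cond[of "s @ w" v] by (simp add: g_def cont_prob_snoc)
  qed
  have best: "0 < g (s @ best_cont q x s c)" if s: "0 < g s" and c: "length s + c \<le> L" for s c
  proof -
    obtain z where z: "z \<in> set_pmf p" "take (length s) z = s" using s g_pos by blast
    \<comment> \<open>A competitor of positive probability, cut out of a support sequence
      \<open>z\<close> that extends \<open>s\<close>.\<close>
    define w where "w = take c (drop (length s) z)"
    have lw: "length w = c" using c len[OF z(1)] by (simp add: w_def)
    have "s @ w = take (length s + c) z"
      using z(2) by (simp add: w_def take_add)
    then have "0 < g (s @ w)" using z(1) c len[OF z(1)] by (auto simp: g_pos)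
    then have "0 < cont_prob q x s w"
      using g_cont[of s w] lw c s by (simp add: zero_less_mult_iff)
    also have "\<dots> \<le> cont_prob q x s (best_cont q x s c)"
      using is_arg_max_best_cont[of q x s c] lw by (simp add: is_arg_max_linorder)
    finally show ?thesis
      using g_cont[of s "best_cont q x s c"] c s by (simp add: length_best_cont)
  qed
  have "0 < g ((lookahead_step L K T q x ^^ n) [])" for n
  proof (induction n)
    case 0
    show ?case by (simp add: g_def)
  next
    case (Suc n)
    \<comment> \<open>The full best continuation has positive probability. The step keeps only its
      first \<open>T\<close> tokens, and a support sequence that extends the whole also extends this
      shorter prefix.\<close>
    let ?s = "(lookahead_step L K T q x ^^ n) []"
    have "length ?s \<le> L" by (simp add: length_funpow_lookahead_step[OF TK])
    then have "0 < g (?s @ best_cont q x ?s (min K (L - length ?s)))"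
      using best[OF Suc.IH] by simp
    then obtain z where "z \<in> set_pmf p"
      "take (length (?s @ best_cont q x ?s (min K (L - length ?s)))) z =
        ?s @ best_cont q x ?s (min K (L - length ?s))"
      unfolding g_pos by blast
    then have "\<exists>z\<in>set_pmf p. \<exists>u. z = lookahead_step L K T q x ?s @ u"
      by (metis append_assoc append_take_drop_id lookahead_step_eq[OF TK])
    then show ?case unfolding g_pos by force
  qed
  \<comment> \<open>The output has full length \<open>L\<close>, so a support sequence starting with
    it is the output itself.\<close>
  then obtain z where "z \<in> set_pmf p" "take (length (lookahead L K T q x)) z = lookahead L K T q x"
    unfolding lookahead_eq_funpow[OF TK] g_pos by blast
  then show ?thesis by (simp add: length_lookahead[OF TK] len)
qed

section \<open>Disintegration\<close>

locale disintegrated = prob_space P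
  for P :: "('x \<times> 'v::finite option list) measure" +
  fixes M :: "'x measure" and Y :: "'v option list set"
    and \<kappa> :: "'x \<Rightarrow> 'v option list pmf" and L :: nat
  assumes length_Y: "\<And>y. y \<in> Y \<Longrightarrow> length y = L"
    and sets_P: "sets P = sets (M \<Otimes>\<^sub>M count_space Y)"
    and output_version: "output_version M Y P \<kappa>"
begin

lemma finite_Y: "finite Y"
  by (rule finite_subset[OF _ finite_length_eq[of L]]) (auto dest: length_Y)

lemma space_P: "space P = space M \<times> Y"
  using sets_eq_imp_space_eq[OF sets_P] by (simp add: space_pair_measure)

lemma Y_nonempty: "Y \<noteq> {}"
  using not_empty by (auto simp: space_P)

lemma measurable_fst_P [measurable]: "fst \<in> P \<rightarrow>\<^sub>M M"
  by (simp add: measurable_cong_sets[OF sets_P refl])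

lemma measurable_snd_P: "snd \<in> P \<rightarrow>\<^sub>M count_space Y"
  by (simp add: measurable_cong_sets[OF sets_P refl])

lemma measurable_snd_P_UNIV [measurable]: "snd \<in> P \<rightarrow>\<^sub>M count_space UNIV"
  using measurable_compose[OF measurable_snd_P, of "\<lambda>y. y" "count_space UNIV"] by simp

lemma set_pmf_kernel: "x \<in> space M \<Longrightarrow> set_pmf (\<kappa> x) \<subseteq> Y"
  using output_version by (simp add: output_version_def)

lemma measurable_pmf_kernel [measurable]: "y \<in> Y \<Longrightarrow> (\<lambda>x. pmf (\<kappa> x) y) \<in> borel_measurable M"
  using output_version by (simp add: output_version_def)

lemma sum_pmf_kernel:
  assumes "x \<in> space M"
  shows "(\<Sum>y\<in>Y. of_bool (R y) * pmf (\<kappa> x) y) = measure_pmf.prob (\<kappa> x) {y. R y}"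
proof -
  have "measure_pmf.prob (\<kappa> x) {y. R y} = measure_pmf.prob (\<kappa> x) {y \<in> Y. R y}"
    using set_pmf_kernel[OF assms] by (intro measure_prob_cong_0) (auto simp: set_pmf_iff)
  also have "\<dots> = (\<Sum>y\<in>{y \<in> Y. R y}. pmf (\<kappa> x) y)"
    using finite_Y by (simp add: measure_measure_pmf_finite)
  also have "\<dots> = (\<Sum>y\<in>Y. of_bool (R y) * pmf (\<kappa> x) y)"
    using finite_Y by (intro sum.mono_neutral_cong_left) auto
  finally show ?thesis by simp
qed

lemma measurable_prob_kernel [measurable]:
  "(\<lambda>x. measure_pmf.prob (\<kappa> x) {y. R y}) \<in> borel_measurable M"
proof -
  have "(\<lambda>x. \<Sum>y\<in>Y. of_bool (R y) * pmf (\<kappa> x) y) \<in> borel_measurable M" by measurable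
  then show ?thesis by (simp add: sum_pmf_kernel cong: measurable_cong)
qed

text \<open>\<open>output_version\<close> is this identity for indicators \<open>g\<close>. It says
  that two measures on \<open>M\<close> agree on all measurable sets, and equal measures have equal
  integrals.\<close>

lemma integral_fiber:
  fixes g :: "'x \<Rightarrow> real"
  assumes y: "y \<in> Y" and [measurable]: "g \<in> borel_measurable M"
  shows "(\<integral>z. g (fst z) * of_bool (snd z = y) \<partial>P) = (\<integral>z. g (fst z) * pmf (\<kappa> (fst z)) y \<partial>P)"
proof -
  \<comment> \<open>\<open>?A\<close> sends a set \<open>A\<close> to the mass of
    \<open>A \<times> {y}\<close>; \<open>?B\<close> has density \<open>pmf (\<kappa> x) y\<close>
    with respect to the input marginal.\<close>
  let ?A = "distr (density P (\<lambda>z. ennreal (of_bool (snd z = y)))) M fst"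
  let ?B = "density (distr P M fst) (\<lambda>x. ennreal (pmf (\<kappa> x) y))"
  note [measurable] = measurable_pmf_kernel[OF y]
  have [measurable]: "(\<lambda>z. of_bool (snd z = y) :: real) \<in> borel_measurable P"
    by (rule measurable_compose[OF measurable_snd_P_UNIV]) simp
  have "?A = ?B"
  proof (rule measure_eqI)
    fix A assume "A \<in> sets ?A"
    then have [measurable]: "A \<in> sets M" by simp
    have *: "A \<times> {y} = {z \<in> space P. fst z \<in> A \<and> snd z = y}"
      using sets.sets_into_space[OF \<open>A \<in> sets M\<close>] y by (auto simp: space_P)
    have [measurable]: "A \<times> {y} \<in> sets P"
      unfolding * by measurable
    have "emeasure ?A A = (\<integral>\<^sup>+z. ennreal (of_bool (snd z = y)) * indicator (fst -` A \<inter> space P) z \<partial>P)"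
      by (simp add: emeasure_distr emeasure_density)
    also have "\<dots> = (\<integral>\<^sup>+z. indicator (A \<times> {y}) z \<partial>P)"
      using y by (intro nn_integral_cong) (auto simp: indicator_def)
    also have "\<dots> = ennreal (measure P (A \<times> {y}))"
      by (simp add: emeasure_eq_measure)
    also have "\<dots> = ennreal (\<integral>z. indicator A (fst z) * pmf (\<kappa> (fst z)) y \<partial>P)"
      using output_version y \<open>A \<in> sets M\<close> by (simp add: output_version_def)
    also have "\<dots> = (\<integral>\<^sup>+z. ennreal (indicator A (fst z) * pmf (\<kappa> (fst z)) y) \<partial>P)"
      by (intro nn_integral_eq_integral[symmetric] integrable_const_bound[where B = 1])
        (auto simp: indicator_def pmf_le_1)
    also have "\<dots> = (\<integral>\<^sup>+x. ennreal (pmf (\<kappa> x) y) * indicator A x \<partial>distr P M fst)"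
      by (subst nn_integral_distr) (auto intro!: nn_integral_cong simp: indicator_def)
    also have "\<dots> = emeasure ?B A"
      by (simp add: emeasure_density)
    finally show "emeasure ?A A = emeasure ?B A" .
  qed simp
  then have "integral\<^sup>L ?A g = integral\<^sup>L ?B g" by simp
  moreover have "integral\<^sup>L ?A g = (\<integral>z. g (fst z) * of_bool (snd z = y) \<partial>P)"
    by (subst integral_distr; (subst integral_density)?) (auto simp: mult.commute)
  moreover have "integral\<^sup>L ?B g = (\<integral>z. g (fst z) * pmf (\<kappa> (fst z)) y \<partial>P)"
    by (subst integral_density; (subst integral_distr)?) (auto simp: mult.commute)
  ultimately show ?thesis by simp
qed

text \<open>As \<open>Y\<close> is finite, the integrand splits into its fibers over
  \<open>Y\<close>, each handled by \<open>integral_fiber\<close>. The bound makes every summand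
  integrable, so sum and integral can be exchanged.\<close>

lemma integral_disintegrate:
  fixes F :: "'x \<Rightarrow> 'v option list \<Rightarrow> real"
  assumes [measurable]: "\<And>y. y \<in> Y \<Longrightarrow> (\<lambda>x. F x y) \<in> borel_measurable M"
    and bound: "\<And>x y. x \<in> space M \<Longrightarrow> y \<in> Y \<Longrightarrow> \<bar>F x y\<bar> \<le> B"
  shows "(\<integral>z. F (fst z) (snd z) \<partial>P) = (\<integral>z. (\<Sum>y\<in>Y. F (fst z) y * pmf (\<kappa> (fst z)) y) \<partial>P)"
proof -
  have [measurable]: "(\<lambda>z. of_bool (snd z = y) :: real) \<in> borel_measurable P" for y
    by (rule measurable_compose[OF measurable_snd_P_UNIV]) simp
  have B: "\<bar>F x y * r\<bar> \<le> B" if "x \<in> space M" "y \<in> Y" "0 \<le> r" "r \<le> 1" for x y r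
    using bound[OF that(1,2)] mult_left_le[OF that(4), of "\<bar>F x y\<bar>"] that(3)
    by (simp add: abs_mult)
  have "(\<Sum>y\<in>Y. F x y * of_bool (w = y)) = F x w" if "w \<in> Y" for x w
    using finite_Y that by (simp add: of_bool_def if_distrib cong: if_cong)
  then have "(\<integral>z. F (fst z) (snd z) \<partial>P) = (\<integral>z. (\<Sum>y\<in>Y. F (fst z) y * of_bool (snd z = y)) \<partial>P)"
    by (intro Bochner_Integration.integral_cong) (auto simp: space_P)
  also have "\<dots> = (\<Sum>y\<in>Y. \<integral>z. F (fst z) y * of_bool (snd z = y) \<partial>P)"
    by (intro Bochner_Integration.integral_sum integrable_const_bound[where B = B] AE_I2)
      (auto simp: space_P intro: bound order_trans[OF abs_ge_zero bound])
  also have "\<dots> = (\<Sum>y\<in>Y. \<integral>z. F (fst z) y * pmf (\<kappa> (fst z)) y \<partial>P)"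
    by (intro sum.cong refl integral_fiber) auto
  also have "\<dots> = (\<integral>z. (\<Sum>y\<in>Y. F (fst z) y * pmf (\<kappa> (fst z)) y) \<partial>P)"
    by (intro Bochner_Integration.integral_sum[symmetric] integrable_const_bound[where B = B] AE_I2)
      (auto simp: space_P pmf_le_1 intro!: B)
  finally show ?thesis .
qed

text \<open>The predictor and the kernel are versions chosen separately, linked only through
  \<open>P\<close>. Both sides have the same integral over every measurable set of inputs, hence
  agree almost everywhere.\<close>

lemma AE_ntp_version:
  assumes q: "ntp_version M L P q"
  shows "AE x in distr P M fst. \<forall>s v. length s < L \<longrightarrow>
    measure_pmf.prob (\<kappa> x) {z. take (length s + 1) z = s @ [v]} =
    measure_pmf.prob (\<kappa> x) {z. take (length s) z = s} * pmf (q x s) v"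
proof -
  interpret \<mu>: prob_space "distr P M fst" by (rule prob_space_distr) simp
  have "AE x in distr P M fst.
    measure_pmf.prob (\<kappa> x) {z. take (length s + 1) z = s @ [v]} =
    measure_pmf.prob (\<kappa> x) {z. take (length s) z = s} * pmf (q x s) v"
    if s: "length s < L" for s v
  proof (rule density_unique_real)
    have [measurable]: "(\<lambda>x. pmf (q x s) v) \<in> borel_measurable M"
      using q s by (simp add: ntp_version_def)
    show "integrable (distr P M fst)
      (\<lambda>x. measure_pmf.prob (\<kappa> x) {z. take (length s + 1) z = s @ [v]})"
      by (rule \<mu>.integrable_const_bound[where B = 1]) auto
    show "integrable (distr P M fst)
      (\<lambda>x. measure_pmf.prob (\<kappa> x) {z. take (length s) z = s} * pmf (q x s) v)"
      by (rule \<mu>.integrable_const_bound[where B = 1]) (auto intro!: mult_le_one pmf_le_1)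
    fix A assume "A \<in> sets (distr P M fst)"
    then have A [measurable]: "A \<in> sets M" by simp
    have "(\<integral>x\<in>A. measure_pmf.prob (\<kappa> x) {z. take (length s + 1) z = s @ [v]} \<partial>distr P M fst)
      = (\<integral>z. indicator A (fst z) * measure_pmf.prob (\<kappa> (fst z)) {z. take (length s + 1) z = s @ [v]} \<partial>P)"
      unfolding set_lebesgue_integral_def by (subst integral_distr) auto
    also have "\<dots> = (\<integral>z. (\<Sum>y\<in>Y. indicator A (fst z) * of_bool (take (length s + 1) y = s @ [v])
        * pmf (\<kappa> (fst z)) y) \<partial>P)"
      by (intro Bochner_Integration.integral_cong refl)
        (auto simp: space_P sum_pmf_kernel[symmetric] sum_distrib_left mult.assoc)
    also have "\<dots> = (\<integral>z. indicator A (fst z) * of_bool (take (length s + 1) (snd z) = s @ [v]) \<partial>P)"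
      by (rule integral_disintegrate[where B = 1, symmetric]) (auto simp: indicator_def)
    also have "\<dots> = measure P {z \<in> space P. fst z \<in> A \<and> take (length s + 1) (snd z) = s @ [v]}"
    proof -
      let ?E = "{z \<in> space P. fst z \<in> A \<and> take (length s + 1) (snd z) = s @ [v]}"
      have "?E \<in> sets P" by measurable
      then have "measure P ?E = (\<integral>z. indicator ?E z \<partial>P)" by simp
      also have "\<dots> = (\<integral>z. indicator A (fst z) * of_bool (take (length s + 1) (snd z) = s @ [v]) \<partial>P)"
        by (intro Bochner_Integration.integral_cong) (auto simp: indicator_def)
      finally show ?thesis by simp
    qed
    \<comment> \<open>Here the kernel's description of the event is exchanged for the
      predictor's.\<close>
    also have "\<dots> = (\<integral>z. indicator A (fst z) * of_bool (take (length s) (snd z) = s) * pmf (q (fst z) s) v \<partial>P)"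
      using q s A unfolding ntp_version_def by blast
    also have "\<dots> = (\<integral>z. (\<Sum>y\<in>Y. indicator A (fst z) * of_bool (take (length s) y = s)
        * pmf (q (fst z) s) v * pmf (\<kappa> (fst z)) y) \<partial>P)"
      by (rule integral_disintegrate[where B = 1]) (auto simp: indicator_def pmf_le_1)
    also have "\<dots> = (\<integral>z. indicator A (fst z) * (measure_pmf.prob (\<kappa> (fst z)) {z. take (length s) z = s} * pmf (q (fst z) s) v) \<partial>P)"
      by (intro Bochner_Integration.integral_cong refl)
        (auto simp: space_P sum_pmf_kernel[symmetric] sum_distrib_left sum_distrib_right ac_simps
          intro!: sum.cong)
    also have "\<dots> = (\<integral>x\<in>A. measure_pmf.prob (\<kappa> x) {z. take (length s) z = s} * pmf (q x s) v \<partial>distr P M fst)"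
      unfolding set_lebesgue_integral_def by (subst integral_distr) auto
    finally show "(\<integral>x\<in>A. measure_pmf.prob (\<kappa> x) {z. take (length s + 1) z = s @ [v]} \<partial>distr P M fst) =
      (\<integral>x\<in>A. measure_pmf.prob (\<kappa> x) {z. take (length s) z = s} * pmf (q x s) v \<partial>distr P M fst)" .
  qed
  \<comment> \<open>There are countably many pairs of a prefix and a token, so one null set serves
    them all.\<close>
  then show ?thesis
    unfolding AE_all_countable by auto
qed

section \<open>Expected N-gram loss and its minimizers\<close>

lemma measurable_ngram_score [measurable]:
  "(\<lambda>x. ngram_score L N \<kappa> x y) \<in> borel_measurable M"
  unfolding ngram_score_def by measurable

lemma ngram_score_nonneg: "0 \<le> ngram_score L N \<kappa> x y"
  by (simp add: ngram_score_def sum_nonneg)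

lemma ngram_score_le: "ngram_score L N \<kappa> x y \<le> real (L - N + 1)"
proof -
  have "ngram_score L N \<kappa> x y \<le> (\<Sum>i = 1..L - N + 1. 1)"
    unfolding ngram_score_def by (rule sum_mono) simp
  then show ?thesis by simp
qed

lemma measurable_ngram_score_compose:
  assumes "d \<in> M \<rightarrow>\<^sub>M count_space UNIV"
  shows "(\<lambda>x. ngram_score L N \<kappa> x (d x)) \<in> borel_measurable M"
  by (rule measurable_compose_countable[OF _ assms]) measurable

lemma integrable_ngram_score:
  assumes "d \<in> M \<rightarrow>\<^sub>M count_space UNIV"
  shows "integrable P (\<lambda>z. ngram_score L N \<kappa> (fst z) (d (fst z)))"
  using ngram_score_nonneg ngram_score_le measurable_ngram_score_compose[OF assms]
  by (intro integrable_const_bound[where B = "real (L - N + 1)"])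
    (auto simp: abs_of_nonneg simp del: of_nat_add)

text \<open>Each of the \<open>L - N + 1\<close> windows contributes its conditional mismatch
  probability, the complement of its term in the score.\<close>

lemma sum_ngram_loss_kernel:
  assumes x: "x \<in> space M"
  shows "(\<Sum>y\<in>Y. ngram_loss L N w y * pmf (\<kappa> x) y) = real (L - N + 1) - ngram_score L N \<kappa> x w"
proof -
  have "(\<Sum>y\<in>Y. ngram_loss L N w y * pmf (\<kappa> x) y) =
      (\<Sum>i = 1..L - N + 1. \<Sum>y\<in>Y. of_bool (seg w i (i + N - 1) \<noteq> seg y i (i + N - 1)) * pmf (\<kappa> x) y)"
    unfolding ngram_loss_def sum_distrib_right by (rule sum.swap)
  also have "\<dots> = (\<Sum>i = 1..L - N + 1. 1 - measure_pmf.prob (\<kappa> x) {y. seg y i (i + N - 1) = seg w i (i + N - 1)})"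
  proof (rule sum.cong[OF refl])
    fix i
    have "{y. seg w i (i + N - 1) \<noteq> seg y i (i + N - 1)} =
        space (measure_pmf (\<kappa> x)) - {y. seg y i (i + N - 1) = seg w i (i + N - 1)}"
      by auto
    then show "(\<Sum>y\<in>Y. of_bool (seg w i (i + N - 1) \<noteq> seg y i (i + N - 1)) * pmf (\<kappa> x) y) =
        1 - measure_pmf.prob (\<kappa> x) {y. seg y i (i + N - 1) = seg w i (i + N - 1)}"
      by (simp only: sum_pmf_kernel[OF x] measure_pmf.prob_compl[simplified sets_measure_pmf, OF UNIV_I])
  qed
  also have "\<dots> = real (L - N + 1) - ngram_score L N \<kappa> x w"
    by (simp add: ngram_score_def sum_subtractf)
  finally show ?thesis .
qed

lemma integral_ngram_loss:
  assumes d: "d \<in> M \<rightarrow>\<^sub>M count_space UNIV"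
  shows "(\<integral>z. ngram_loss L N (d (fst z)) (snd z) \<partial>P) =
    real (L - N + 1) - (\<integral>z. ngram_score L N \<kappa> (fst z) (d (fst z)) \<partial>P)"
proof -
  have "\<bar>ngram_loss L N w y\<bar> \<le> real (L - N + 1)" for w y
  proof -
    have "\<bar>ngram_loss L N w y\<bar> \<le> (\<Sum>i = 1..L - N + 1. \<bar>of_bool (seg w i (i + N - 1) \<noteq> seg y i (i + N - 1))\<bar>)"
      unfolding ngram_loss_def by (rule sum_abs)
    also have "\<dots> \<le> (\<Sum>i = 1..L - N + 1. 1)" by (rule sum_mono) simp
    finally show ?thesis by simp
  qed
  moreover have "(\<lambda>x. ngram_loss L N (d x) y) \<in> borel_measurable M" for y
    by (rule measurable_compose[OF d]) simp
  ultimately have "(\<integral>z. ngram_loss L N (d (fst z)) (snd z) \<partial>P) =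
      (\<integral>z. (\<Sum>y\<in>Y. ngram_loss L N (d (fst z)) y * pmf (\<kappa> (fst z)) y) \<partial>P)"
    by (intro integral_disintegrate[of "\<lambda>x. ngram_loss L N (d x)"]) auto
  also have "\<dots> = (\<integral>z. real (L - N + 1) - ngram_score L N \<kappa> (fst z) (d (fst z)) \<partial>P)"
    by (intro Bochner_Integration.integral_cong) (auto simp: space_P sum_ngram_loss_kernel)
  also have "\<dots> = real (L - N + 1) - (\<integral>z. ngram_score L N \<kappa> (fst z) (d (fst z)) \<partial>P)"
    using integrable_ngram_score[OF d] by (subst Bochner_Integration.integral_diff) (auto simp: prob_space)
  finally show ?thesis .
qed

lemma is_arg_max_y_dagger:
  "is_arg_max (ngram_score L N \<kappa> x) (\<lambda>y. y \<in> Y) (y_dagger L N Y \<kappa> x)"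
  unfolding y_dagger_def by (rule is_arg_max_arg_max_on[OF finite_Y Y_nonempty])

lemma y_dagger_in_Y: "y_dagger L N Y \<kappa> x \<in> Y"
  using is_arg_max_y_dagger by (simp add: is_arg_max_def)

lemma ngram_score_le_y_dagger:
  "y \<in> Y \<Longrightarrow> ngram_score L N \<kappa> x y \<le> ngram_score L N \<kappa> x (y_dagger L N Y \<kappa> x)"
  using is_arg_max_y_dagger[of N x] by (simp add: is_arg_max_linorder)

lemma measurable_y_dagger: "y_dagger L N Y \<kappa> \<in> M \<rightarrow>\<^sub>M count_space UNIV"
  unfolding y_dagger_def[abs_def] by (intro measurable_arg_max_on finite_Y) measurable

text \<open>The excess loss of \<open>d\<close> is the integral of its score gap to
  \<open>y_dagger\<close>. The gap is almost surely nonnegative, so its integral vanishes iff the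
  gap does almost surely, and by \<open>unique\<close> a zero gap forces equality. Values in
  \<open>Y\<close> are asked only almost surely because lookahead may leave \<open>Y\<close> on a
  null set.\<close>

lemma optimal_decoder_iff:
  assumes d: "d \<in> M \<rightarrow>\<^sub>M count_space UNIV"
    and d_Y: "AE x in distr P M fst. d x \<in> Y"
    and unique: "\<And>x. x \<in> space M \<Longrightarrow> \<exists>!y. is_arg_max (ngram_score L N \<kappa> x) (\<lambda>y. y \<in> Y) y"
  shows "optimal_decoder M L N Y P d \<longleftrightarrow> (AE x in distr P M fst. d x = y_dagger L N Y \<kappa> x)"
proof -
  let ?y = "y_dagger L N Y \<kappa>"
  let ?S = "\<lambda>d z. ngram_score L N \<kappa> (fst z) (d (fst z))"
  have to_UNIV: "h \<in> M \<rightarrow>\<^sub>M count_space UNIV" if "h \<in> M \<rightarrow>\<^sub>M count_space Y" for h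
    using measurable_compose[OF that, of "\<lambda>y. y" "count_space UNIV"] by simp
  have y_meas: "?y \<in> M \<rightarrow>\<^sub>M count_space Y"
    using finite_Y measurable_y_dagger[of N] y_dagger_in_Y
    by (auto simp: measurable_count_space_eq2 dest: measurable_sets)
  \<comment> \<open>\<open>y_dagger\<close> is itself a measurable competitor, so the infimum is a
    minimum attained there.\<close>
  have inf: "(INF h\<in>measurable M (count_space Y). \<integral>z. ngram_loss L N (h (fst z)) (snd z) \<partial>P) =
      (\<integral>z. ngram_loss L N (?y (fst z)) (snd z) \<partial>P)"
  proof (rule cInf_eq_minimum)
    show "(\<integral>z. ngram_loss L N (?y (fst z)) (snd z) \<partial>P) \<in>
        (\<lambda>h. \<integral>z. ngram_loss L N (h (fst z)) (snd z) \<partial>P) ` measurable M (count_space Y)"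
      using y_meas by blast
    fix r assume "r \<in> (\<lambda>h. \<integral>z. ngram_loss L N (h (fst z)) (snd z) \<partial>P) ` measurable M (count_space Y)"
    then obtain h where h: "h \<in> M \<rightarrow>\<^sub>M count_space Y"
      and r: "r = (\<integral>z. ngram_loss L N (h (fst z)) (snd z) \<partial>P)" by blast
    have "(\<integral>z. ?S h z \<partial>P) \<le> (\<integral>z. ?S ?y z \<partial>P)"
      using h measurable_space[OF h]
      by (intro integral_mono integrable_ngram_score measurable_y_dagger to_UNIV)
        (auto simp: space_P intro!: ngram_score_le_y_dagger)
    then show "(\<integral>z. ngram_loss L N (?y (fst z)) (snd z) \<partial>P) \<le> r"
      by (simp add: r integral_ngram_loss to_UNIV[OF h] measurable_y_dagger)
  qed
  have int: "integrable P (\<lambda>z. ?S ?y z - ?S d z)"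
    by (intro Bochner_Integration.integrable_diff integrable_ngram_score measurable_y_dagger d)
  have d_Y_P: "AE z in P. d (fst z) \<in> Y"
    by (rule AE_distrD[OF measurable_fst_P d_Y])
  have eq_meas: "{x \<in> space M. d x = ?y x} \<in> sets M"
    using d measurable_y_dagger[of N] by measurable
  have "optimal_decoder M L N Y P d \<longleftrightarrow> (\<integral>z. ?S ?y z - ?S d z \<partial>P) = 0"
    unfolding optimal_decoder_def inf
    by (auto simp: integral_ngram_loss d measurable_y_dagger integrable_ngram_score)
  also have "\<dots> \<longleftrightarrow> (AE z in P. ?S ?y z - ?S d z = 0)"
    using d_Y_P by (intro integral_nonneg_eq_0_iff_AE int) (auto simp: ngram_score_le_y_dagger)
  also have "\<dots> \<longleftrightarrow> (AE z in P. d (fst z) = ?y (fst z))"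
  proof -
    have "AE z in P. ?S ?y z - ?S d z = 0 \<longleftrightarrow> d (fst z) = ?y (fst z)"
      using d_Y_P AE_space
    proof eventually_elim
      case (elim z)
      then have x: "fst z \<in> space M" by (auto simp: space_P)
      show ?case
      proof
        assume "?S ?y z - ?S d z = 0"
        then have "is_arg_max (ngram_score L N \<kappa> (fst z)) (\<lambda>y. y \<in> Y) (d (fst z))"
          using is_arg_max_y_dagger[of N "fst z"] elim by (simp add: is_arg_max_linorder)
        then show "d (fst z) = ?y (fst z)"
          using unique[OF x] is_arg_max_y_dagger by blast
      qed simp
    qed
    then show ?thesis by (intro iffI) (auto elim: AE_mp)
  qed
  also have "\<dots> \<longleftrightarrow> (AE x in distr P M fst. d x = ?y x)"
    using AE_distr_iff[OF measurable_fst_P eq_meas] by simp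
  finally show ?thesis .
qed

end

theorem theorem4p4:
  fixes M :: "'x measure"
    and Y :: "'v::finite option list set"
    and P :: "('x \<times> 'v option list) measure"
    and \<kappa> :: "'x \<Rightarrow> 'v option list pmf"
    and q :: "'x \<Rightarrow> 'v option list \<Rightarrow> 'v option pmf"
    and L N K T :: nat
  assumes "\<And>y. y \<in> Y \<Longrightarrow> padded L y"
    and "in_class M L Y P \<kappa> q"
    and "1 \<le> T" and "T \<le> K" and "K \<le> L"
    and "1 \<le> N" and "N \<le> L"
  shows "optimal_decoder M L N Y P (lookahead L K T q) \<longleftrightarrow>
    measure (distr P M fst) (agree_set M L N K T Y \<kappa> q) = 1"
proof -
  have joint: "joint_distribution M Y P" and out: "output_version M Y P \<kappa>"
    and ntp: "ntp_version M L P q" and ties: "no_ties M L Y \<kappa> q"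
    using assms(2) by (auto simp: in_class_def)
  interpret P: prob_space P using joint by (simp add: joint_distribution_def)
  interpret disintegrated P M Y \<kappa> L
  proof
    show "length y = L" if "y \<in> Y" for y using assms(1)[OF that] by (auto simp: padded_def)
  qed (use joint out in \<open>auto simp: joint_distribution_def\<close>)
  interpret \<mu>: prob_space "distr P M fst" by (rule P.prob_space_distr) simp
  let ?d = "lookahead L K T q"
  have d: "?d \<in> M \<rightarrow>\<^sub>M count_space UNIV"
    using ntp assms(3,4) by (intro measurable_lookahead) (auto simp: ntp_version_def)
  \<comment> \<open>The predictor obeys the chain rule of \<open>\<kappa> x\<close> only off a null
    set of inputs; there the output lies in the support of \<open>\<kappa> x\<close>, hence in
    \<open>Y\<close>.\<close>
  have "AE x in distr P M fst. ?d x \<in> Y"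
    using AE_ntp_version[OF ntp] AE_space
  proof eventually_elim
    case (elim x)
    then have "x \<in> space M" by simp
    have "?d x \<in> set_pmf (\<kappa> x)"
      using elim(1) set_pmf_kernel[OF \<open>x \<in> space M\<close>] length_Y assms(3,4)
      by (intro lookahead_in_set_pmf) auto
    then show ?case using set_pmf_kernel[OF \<open>x \<in> space M\<close>] by blast
  qed
  moreover have "\<exists>!y. is_arg_max (ngram_score L N \<kappa> x) (\<lambda>y. y \<in> Y) y" if "x \<in> space M" for x
    using ties that assms(6,7) by (simp add: no_ties_def)
  ultimately have "optimal_decoder M L N Y P ?d \<longleftrightarrow>
      (AE x in distr P M fst. ?d x = y_dagger L N Y \<kappa> x)"
    by (intro optimal_decoder_iff d)
  also have "\<dots> \<longleftrightarrow> (AE x in distr P M fst. x \<in> {x \<in> space M. ?d x = y_dagger L N Y \<kappa> x})"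
    by (intro AE_cong) simp
  also have "\<dots> \<longleftrightarrow> measure (distr P M fst) {x \<in> space M. ?d x = y_dagger L N Y \<kappa> x} = 1"
    using d measurable_y_dagger[of N] by (intro \<mu>.AE_in_set_eq_1) simp
  \<comment> \<open>By \<open>lookahead_eq_iff\<close> the two sets are equal at every input, not
    just almost surely. This also makes \<open>agree_set\<close> measurable, so that its
    \<open>measure\<close> is not a default value.\<close>
  also have "{x \<in> space M. ?d x = y_dagger L N Y \<kappa> x} = agree_set M L N K T Y \<kappa> q"
    unfolding agree_set_def
    by (intro Collect_cong conj_cong refl lookahead_eq_iff assms(3,4) length_Y y_dagger_in_Y)
  finally show ?thesis .
qed

end
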